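(* Let $\mathcal{X}$ be a commutative association scheme on a vertex set $\Omega$ whose thin radical $G$ acts regularly (by multiplication) on the thick relations. Then, for any vertex $z\in\Omega$ and any thick relation $S$, $\mathcal{X}$ is uniquely recoverable from $G$ (with its natural permutation action on $\Omega$) together with the restrictions of all relations of $\mathcal{X}$ to the set $\{z\}\cup S(z)$; that is, these data uniquely determine all relations of $\mathcal{X}$.
   Context: Association schemes are commutative: a partition of $\Omega\times\Omega$ into relations including the identity, closed under transpose, with intersection numbers $p_{ij}^k$ satisfying $p_{ij}^k=p_{ji}^k$. A relation is thin if it has valency $1$ (adjacency matrix a permutation matrix) and thick otherwise; the thin relations form a group $G$ (the thin radical) under product of adjacency matrices, and $G$ acts on $\Omega$ by $x^g=$ the unique $y$ with $(x,y)\in T_g$. The thin radical acts regularly on the thick relations if for each thin $\mathsf{T}_g$ and each thick $\mathsf{S}$, $\mathsf{T}_g\mathsf{S}$ is the adjacency matrix of a thick relation, and for a fixed thick $\mathsf{S}$ the map $g\mapsto\mathsf{T}_g\mathsf{S}$ is a bijection from $G$ onto the thick adjacency matrices. For a relation $R$ and vertex $z$, $R(z)=\{x:(z,x)\in R\}$.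
   Formalization: The data are taken to include the multiplication action of G on the thick relations, i.e. which restriction belongs to which T_gS; with only G acting on Ω and unlabelled restrictions, recovery fails (e.g. on F_3^2×Z_3 with det versus −det). Ω is taken finite. *)

theory Defs
  imports Main "HOL-Library.Disjoint_Sets"
begin

text \<open>A scheme is given by its set \<open>X\<close> of relations.
  The number \<open>p P Q R\<close> is the intersection number usually written
  \<open>p\<^sub>i\<^sub>j\<^sup>k\<close> for \<open>P = R\<^sub>i\<close>, \<open>Q = R\<^sub>j\<close>, \<open>R = R\<^sub>k\<close>.\<close>

locale commutative_association_scheme =
  fixes \<Omega> :: "'a set" and X :: "'a rel set"
  assumes finite_vertices: "finite \<Omega>"
    and partition: "partition_on (\<Omega> \<times> \<Omega>) X"
    and identity: "Id_on \<Omega> \<in> X"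
    and transpose: "\<And>R. R \<in> X \<Longrightarrow> R\<inverse> \<in> X"
    and intersection_numbers:
      "\<exists>p. \<forall>P\<in>X. \<forall>Q\<in>X. \<forall>R\<in>X.
         (\<forall>(x, y)\<in>R. card {w \<in> \<Omega>. (x, w) \<in> P \<and> (w, y) \<in> Q} = (p P Q R :: nat)) \<and>
         p P Q R = p Q P R"

definition has_valency :: "'a set \<Rightarrow> 'a rel \<Rightarrow> nat \<Rightarrow> bool" where
  "has_valency \<Omega> R k \<longleftrightarrow> (\<forall>x\<in>\<Omega>. card (R `` {x}) = k)"

definition thin_relations :: "'a set \<Rightarrow> 'a rel set \<Rightarrow> 'a rel set" where
  "thin_relations \<Omega> X = {R \<in> X. has_valency \<Omega> R 1}"

definition thick_relations :: "'a set \<Rightarrow> 'a rel set \<Rightarrow> 'a rel set" where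
  "thick_relations \<Omega> X = {R \<in> X. \<not> has_valency \<Omega> R 1}"

definition adj :: "'a rel \<Rightarrow> 'a \<Rightarrow> 'a \<Rightarrow> int" where
  "adj R x y = of_bool ((x, y) \<in> R)"

definition mat_prod :: "'a set \<Rightarrow> ('a \<Rightarrow> 'a \<Rightarrow> int) \<Rightarrow> ('a \<Rightarrow> 'a \<Rightarrow> int) \<Rightarrow> 'a \<Rightarrow> 'a \<Rightarrow> int" where
  "mat_prod \<Omega> A B x y = (\<Sum>w\<in>\<Omega>. A x w * B w y)"

text \<open>The element \<open>g\<close> of the thin radical \<open>G\<close> is identified with its thin relation
  \<open>T = T\<^sub>g\<close>, so that \<open>thin_act T x\<close> is \<open>x\<^sup>g\<close>. The action is faithful,
  hence the group structure of \<open>G\<close> can be read off from the permutations.\<close>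

definition thin_act :: "'a rel \<Rightarrow> 'a \<Rightarrow> 'a" where
  "thin_act T x = (THE y. (x, y) \<in> T)"

definition thin_radical_regular_on_thick :: "'a set \<Rightarrow> 'a rel set \<Rightarrow> bool" where
  "thin_radical_regular_on_thick \<Omega> X \<longleftrightarrow>
     (\<forall>T\<in>thin_relations \<Omega> X. \<forall>S\<in>thick_relations \<Omega> X.
        mat_prod \<Omega> (adj T) (adj S) \<in> adj ` thick_relations \<Omega> X) \<and>
     (\<forall>S\<in>thick_relations \<Omega> X.
        bij_betw (\<lambda>T. mat_prod \<Omega> (adj T) (adj S))
          (thin_relations \<Omega> X) (adj ` thick_relations \<Omega> X))"

definition restrict_rel :: "'a rel \<Rightarrow> 'a set \<Rightarrow> 'a rel" where
  "restrict_rel R Y = R \<inter> Y \<times> Y"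

text \<open>Two schemes \<open>X\<close> and \<open>X'\<close> have the same recovery data on \<open>Y\<close>, where \<open>f\<close> sends
  a relation of \<open>X\<close> to the relation of \<open>X'\<close> carrying the same name: they have the same
  thin radical with the same permutation action, \<open>G\<close> permutes the names of the thick
  relations in the same way, and relations with the same name have the same restriction
  to \<open>Y\<close>.

  That the restrictions are named compatibly with the action of \<open>G\<close> (so that the
  restriction of \<open>T\<^sub>g S\<close> is known as such) is essential: with arbitrarily named
  restrictions there is no uniqueness. For instance, on vertices \<open>(u, i)\<close> with \<open>u\<close> a vector of
  the plane over the field with 3 elements and \<open>i\<close> modulo 3, the relations
  \<open>j - i = det(u, v) + g\<close> for \<open>u \<noteq> v\<close> and \<open>j - i = g\<close> for \<open>u = v\<close> form a
  scheme; replacing \<open>det\<close> by \<open>-det\<close> gives a different one with the same \<open>G\<close>, in which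
  the restrictions to \<open>Y\<close> (for \<open>z = (0, 0)\<close>, \<open>S(z)\<close> all \<open>(v, 0)\<close> with \<open>v \<noteq> 0\<close>)
  are the same up to exchanging the names \<open>g\<close> and \<open>-g\<close> of the thick relations.\<close>

definition same_recovery_data ::
  "'a set \<Rightarrow> 'a set \<Rightarrow> ('a rel \<Rightarrow> 'a rel) \<Rightarrow> 'a rel set \<Rightarrow> 'a rel set \<Rightarrow> bool" where
  "same_recovery_data \<Omega> Y f X X' \<longleftrightarrow>
     bij_betw f X X' \<and>
     f ` thin_relations \<Omega> X = thin_relations \<Omega> X' \<and>
     (\<forall>T\<in>thin_relations \<Omega> X. \<forall>x\<in>\<Omega>. thin_act (f T) x = thin_act T x) \<and>
     (\<forall>T\<in>thin_relations \<Omega> X. \<forall>R\<in>thick_relations \<Omega> X. \<forall>Q\<in>thick_relations \<Omega> X.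
        adj Q = mat_prod \<Omega> (adj T) (adj R) \<longrightarrow>
        adj (f Q) = mat_prod \<Omega> (adj (f T)) (adj (f R))) \<and>
     (\<forall>R\<in>X. restrict_rel (f R) Y = restrict_rel R Y)"

end

theory Submission imports Defs begin

text \<open>Since thin relations commute with all relations, \<open>\<Omega>\<close> is the union of the \<open>G\<close>-translates
  of \<open>Y = {z} \<union> S(z)\<close>: a point related to \<open>z\<close> by the thick relation \<open>T\<^sub>g S = S T\<^sub>g\<close> has the
  form \<open>s\<^sup>g\<close> with \<open>s \<in> S(z)\<close>. If \<open>x = a\<^sup>g\<close> and \<open>y = b\<^sup>h\<close> with \<open>a, b \<in> Y\<close>, then for a thick \<open>R\<close>,
  \<open>(x, y) \<in> R\<close> is equivalent to \<open>(a, b) \<in> T\<^sub>h\<inverse> T\<^sub>g R\<close>, which is visible on \<open>Y\<close>.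
  So every relation is contained in the one of the other scheme with the same name, and two
  partitions matched in this way coincide.\<close>

text \<open>All summands of the matrix product are nonnegative, so nothing cancels: an entry is
  nonzero iff some \<open>w\<close> links \<open>x\<close> to \<open>y\<close>. The bound on
  \<open>P\<close> keeps such a \<open>w\<close> inside the range of summation.\<close>

lemma relcomp_eq_if_adj_eq_mat_prod:
  assumes "finite \<Omega>" and "P \<subseteq> \<Omega> \<times> \<Omega>" and adj: "adj R = mat_prod \<Omega> (adj P) (adj Q)"
  shows "R = P O Q"
proof -
  have "(x, y) \<in> R \<longleftrightarrow> (x, y) \<in> P O Q" for x y
  proof -
    have "(x, y) \<in> R \<longleftrightarrow> adj R x y \<noteq> 0"
      by (simp add: adj_def)
    also have "\<dots> \<longleftrightarrow> (\<exists>w\<in>\<Omega>. adj P x w * adj Q w y \<noteq> 0)"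
      unfolding adj mat_prod_def using \<open>finite \<Omega>\<close>
      by (subst sum_nonneg_eq_0_iff) (auto simp: adj_def)
    also have "\<dots> \<longleftrightarrow> (x, y) \<in> P O Q"
      using \<open>P \<subseteq> \<Omega> \<times> \<Omega>\<close> by (auto simp: adj_def)
    finally show ?thesis .
  qed
  then show ?thesis by auto
qed

text \<open>A point of \<open>f R\<close> lies in some block \<open>Q\<close> of \<open>X\<close>,
  hence also in \<open>f Q\<close>. Blocks of \<open>X'\<close> that meet coincide, and injectivity
  of \<open>f\<close> then forces \<open>Q = R\<close>.\<close>

lemma partition_on_eq_if_bij_betw_subset:
  assumes X: "partition_on A X" and X': "partition_on A X'"
    and f: "bij_betw f X X'" and sub: "\<And>R. R \<in> X \<Longrightarrow> R \<subseteq> f R"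
  shows "X' = X \<and> (\<forall>R\<in>X. f R = R)"
proof -
  have "f R = R" if R: "R \<in> X" for R
  proof
    show "R \<subseteq> f R" using sub R .
    show "f R \<subseteq> R"
    proof
      fix a assume a: "a \<in> f R"
      have fR: "f R \<in> X'" using f R by (auto simp: bij_betw_def)
      then have "a \<in> A" using a X' by (auto simp: partition_on_def)
      then obtain Q where Q: "Q \<in> X" "a \<in> Q" using X by (auto simp: partition_on_def)
      have "f Q \<in> X'" using f Q by (auto simp: bij_betw_def)
      then have "f Q = f R"
        using sub[OF Q(1)] Q(2) a fR X' by (auto simp: partition_on_def disjoint_def)
      then have "Q = R" using f Q R by (auto simp: bij_betw_def inj_on_def)
      then show "a \<in> R" using Q by simp
    qed
  qed
  then show ?thesis using f by (auto simp: bij_betw_def)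
qed

context commutative_association_scheme
begin

lemma relation_subset: "R \<in> X \<Longrightarrow> R \<subseteq> \<Omega> \<times> \<Omega>"
  using partition by (auto simp: partition_on_def)

lemma relation_containing:
  assumes "x \<in> \<Omega>" "y \<in> \<Omega>"
  obtains R where "R \<in> X" "(x, y) \<in> R"
  using partition assms by (auto simp: partition_on_def)

text \<open>Membership of a pair in \<open>P O Q\<close> means that an intersection number is
  nonzero, and this number is symmetric in \<open>P\<close> and \<open>Q\<close>.\<close>

lemma relcomp_subset_commute:
  assumes P: "P \<in> X" and Q: "Q \<in> X"
  shows "P O Q \<subseteq> Q O P"
proof
  fix e assume "e \<in> P O Q"
  then obtain x w y where e: "e = (x, y)" and xw: "(x, w) \<in> P" and wy: "(w, y) \<in> Q"
    by auto
  have in_\<Omega>: "x \<in> \<Omega>" "w \<in> \<Omega>" "y \<in> \<Omega>"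
    using relation_subset[OF P] relation_subset[OF Q] xw wy by auto
  obtain R where R: "R \<in> X" "(x, y) \<in> R"
    using relation_containing in_\<Omega> by metis
  have "card {w \<in> \<Omega>. (x, w) \<in> P \<and> (w, y) \<in> Q} = card {w \<in> \<Omega>. (x, w) \<in> Q \<and> (w, y) \<in> P}"
  proof -
    obtain p where "\<forall>P\<in>X. \<forall>Q\<in>X. \<forall>R\<in>X.
        (\<forall>(x, y)\<in>R. card {w \<in> \<Omega>. (x, w) \<in> P \<and> (w, y) \<in> Q} = (p P Q R :: nat)) \<and>
        p P Q R = p Q P R"
      using intersection_numbers by (rule exE)
    then have "\<forall>(x, y)\<in>R. card {w \<in> \<Omega>. (x, w) \<in> P \<and> (w, y) \<in> Q} = p P Q R"
      and "\<forall>(x, y)\<in>R. card {w \<in> \<Omega>. (x, w) \<in> Q \<and> (w, y) \<in> P} = p Q P R"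
      and "p P Q R = p Q P R"
      using P Q R(1) by blast+
    then show ?thesis using R(2) by (auto dest!: bspec)
  qed
  \<comment> \<open>Finiteness matters here: \<open>card\<close> is 0 on infinite sets.\<close>
  moreover have "card {w \<in> \<Omega>. (x, w) \<in> P \<and> (w, y) \<in> Q} \<noteq> 0"
    using xw wy in_\<Omega> finite_vertices by auto
  ultimately have "{w \<in> \<Omega>. (x, w) \<in> Q \<and> (w, y) \<in> P} \<noteq> {}" by force
  then show "e \<in> Q O P" using e by auto
qed

lemma relcomp_commute: "P \<in> X \<Longrightarrow> Q \<in> X \<Longrightarrow> P O Q = Q O P"
  by (simp add: relcomp_subset_commute subset_antisym)

lemma thin_relation_in: "T \<in> thin_relations \<Omega> X \<Longrightarrow> T \<in> X"
  by (simp add: thin_relations_def)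

text \<open>Valency 1 makes the \<open>THE\<close> in \<open>thin_act\<close> well defined on
  \<open>\<Omega>\<close>. Outside \<open>\<Omega>\<close> its value is unspecified, hence the
  guard.\<close>

lemma thin_relation_iff:
  assumes "T \<in> thin_relations \<Omega> X"
  shows "(x, y) \<in> T \<longleftrightarrow> x \<in> \<Omega> \<and> thin_act T x = y"
proof (cases "x \<in> \<Omega>")
  case True
  then have "card (T `` {x}) = 1"
    using assms by (simp add: thin_relations_def has_valency_def)
  then obtain u where "T `` {x} = {u}" by (rule card_1_singletonE)
  then have u: "(x, v) \<in> T \<longleftrightarrow> v = u" for v by auto
  then show ?thesis using True by (auto simp: thin_act_def)
next
  case False
  then show ?thesis using relation_subset[OF thin_relation_in[OF assms]] by auto
qed

text \<open>Valency 1 controls successors only. Commuting \<open>T\<close> with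
  \<open>T\<inverse>\<close> carries both existence and uniqueness over to predecessors.\<close>

lemma converse_thin_relation:
  assumes T: "T \<in> thin_relations \<Omega> X"
  shows "T\<inverse> \<in> thin_relations \<Omega> X"
proof -
  have X: "T \<in> X" "T\<inverse> \<in> X" using thin_relation_in[OF T] transpose by blast+
  note comm = relcomp_commute[OF this]
  have "card (T\<inverse> `` {x}) = 1" if x: "x \<in> \<Omega>" for x
  proof -
    have "(x, thin_act T x) \<in> T" using x by (simp add: thin_relation_iff[OF T])
    then have "(x, x) \<in> T\<inverse> O T" using comm by blast
    then obtain v where v: "(v, x) \<in> T" by blast
    have "u = v" if "(u, x) \<in> T" for u
    proof -
      have "(u, v) \<in> T\<inverse> O T" using comm v that by blast
      then obtain t where "(t, u) \<in> T" "(t, v) \<in> T" by blast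
      then show ?thesis by (simp add: thin_relation_iff[OF T])
    qed
    then have "T\<inverse> `` {x} = {v}" using v by blast
    then show ?thesis by simp
  qed
  then show ?thesis using X by (simp add: thin_relations_def has_valency_def)
qed

lemma thick_relation_in: "R \<in> thick_relations \<Omega> X \<Longrightarrow> R \<in> X"
  by (simp add: thick_relations_def)

lemma thin_or_thick: "R \<in> X \<Longrightarrow> R \<in> thin_relations \<Omega> X \<or> R \<in> thick_relations \<Omega> X"
  by (auto simp: thin_relations_def thick_relations_def)

lemma relcomp_eq_if_thin_mat_prod:
  assumes "T \<in> thin_relations \<Omega> X" and "adj Q = mat_prod \<Omega> (adj T) (adj R)"
  shows "Q = T O R"
  using assms finite_vertices relation_subset thin_relation_in relcomp_eq_if_adj_eq_mat_prod
  by metis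

lemma thin_translate_of_neighbourhood:
  assumes reg: "thin_radical_regular_on_thick \<Omega> X" and z: "z \<in> \<Omega>" and w: "w \<in> \<Omega>"
    and S: "S \<in> thick_relations \<Omega> X"
  obtains a T where "a \<in> {z} \<union> S `` {z}" "T \<in> thin_relations \<Omega> X" "(a, w) \<in> T"
proof -
  obtain K where K: "K \<in> X" "(z, w) \<in> K" using relation_containing z w by metis
  then consider "K \<in> thin_relations \<Omega> X" | "K \<in> thick_relations \<Omega> X"
    using thin_or_thick by blast
  then show thesis
  proof cases
    case 1
    then show thesis using K that by blast
  next
    case 2
    \<comment> \<open>Surjectivity in the regular action writes \<open>K\<close> as a translate of
      \<open>S\<close>.\<close>
    have "(\<lambda>T. mat_prod \<Omega> (adj T) (adj S)) ` thin_relations \<Omega> X = adj ` thick_relations \<Omega> X"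
      using reg S by (auto simp: thin_radical_regular_on_thick_def bij_betw_def)
    then obtain T where T: "T \<in> thin_relations \<Omega> X" "adj K = mat_prod \<Omega> (adj T) (adj S)"
      using 2 by (metis (no_types, lifting) imageE imageI)
    then have "K = T O S" by (rule relcomp_eq_if_thin_mat_prod)
    also have "\<dots> = S O T"
      using relcomp_commute T(1) S thin_relation_in thick_relation_in by blast
    finally obtain s where "(z, s) \<in> S" "(s, w) \<in> T" using K by auto
    then show thesis using T(1) that by blast
  qed
qed

end

theorem theorem5p1:
  fixes \<Omega> :: "'a set" and X X' :: "'a rel set" and S :: "'a rel" and z :: 'a
    and f :: "'a rel \<Rightarrow> 'a rel"
  assumes "commutative_association_scheme \<Omega> X"
    and "thin_radical_regular_on_thick \<Omega> X"
    and "commutative_association_scheme \<Omega> X'"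
    and "thin_radical_regular_on_thick \<Omega> X'"
    and "z \<in> \<Omega>"
    and "S \<in> thick_relations \<Omega> X"
    and "same_recovery_data \<Omega> ({z} \<union> S `` {z}) f X X'"
  shows "X' = X \<and> (\<forall>R\<in>X. f R = R)"
proof -
  interpret A: commutative_association_scheme \<Omega> X by fact
  interpret B: commutative_association_scheme \<Omega> X' by fact
  define Y where "Y = {z} \<union> S `` {z}"
  have bij: "bij_betw f X X'"
    and thin: "f ` thin_relations \<Omega> X = thin_relations \<Omega> X'"
    and act: "\<And>T x. T \<in> thin_relations \<Omega> X \<Longrightarrow> x \<in> \<Omega> \<Longrightarrow> thin_act (f T) x = thin_act T x"
    and prod: "\<And>T R Q. T \<in> thin_relations \<Omega> X \<Longrightarrow> R \<in> thick_relations \<Omega> X \<Longrightarrow>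
      Q \<in> thick_relations \<Omega> X \<Longrightarrow> adj Q = mat_prod \<Omega> (adj T) (adj R) \<Longrightarrow>
      adj (f Q) = mat_prod \<Omega> (adj (f T)) (adj (f R))"
    and restr: "\<And>R. R \<in> X \<Longrightarrow> restrict_rel (f R) Y = restrict_rel R Y"
    using assms(7) unfolding same_recovery_data_def Y_def by blast+
  have f_in: "f R \<in> X'" if "R \<in> X" for R using bij that by (auto simp: bij_betw_def)
  \<comment> \<open>A thin relation is the graph of its permutation, which the data fix.\<close>
  have f_thin: "f T = T" if T: "T \<in> thin_relations \<Omega> X" for T
  proof -
    have "f T \<in> thin_relations \<Omega> X'" using T thin by blast
    then have "(x, y) \<in> f T \<longleftrightarrow> (x, y) \<in> T" for x y
      using act[OF T] by (auto simp: B.thin_relation_iff A.thin_relation_iff[OF T])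
    then show ?thesis by auto
  qed
  have thin': "T \<in> thin_relations \<Omega> X'" if "T \<in> thin_relations \<Omega> X" for T
    using f_thin thin that by (metis imageI)
  \<comment> \<open>Translates stay thick, so this fact can be applied twice in a row.\<close>
  have translate: "T O R \<in> thick_relations \<Omega> X \<and> f (T O R) = T O f R"
    if T: "T \<in> thin_relations \<Omega> X" and R: "R \<in> thick_relations \<Omega> X" for T R
  proof -
    have "mat_prod \<Omega> (adj T) (adj R) \<in> adj ` thick_relations \<Omega> X"
      using assms(2) T R unfolding thin_radical_regular_on_thick_def by blast
    then obtain Q where Q: "Q \<in> thick_relations \<Omega> X" "adj Q = mat_prod \<Omega> (adj T) (adj R)"
      by auto
    have "Q = T O R" using A.relcomp_eq_if_thin_mat_prod[OF T Q(2)] .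
    moreover have "f Q = T O f R"
      using prod[OF T R Q] B.relcomp_eq_if_thin_mat_prod[OF thin'[OF T]] f_thin[OF T] by simp
    ultimately show ?thesis using Q by simp
  qed
  have thick_subset: "R \<subseteq> f R" if R: "R \<in> thick_relations \<Omega> X" for R
  proof clarify
    fix x y assume xy: "(x, y) \<in> R"
    then have "x \<in> \<Omega>" "y \<in> \<Omega>" using A.relation_subset[OF A.thick_relation_in[OF R]] by auto
    then obtain a T b U where a: "a \<in> Y" "T \<in> thin_relations \<Omega> X" "(a, x) \<in> T"
      and b: "b \<in> Y" "U \<in> thin_relations \<Omega> X" "(b, y) \<in> U"
      using A.thin_translate_of_neighbourhood[OF assms(2,5) _ assms(6)] unfolding Y_def by metis
    note U = A.converse_thin_relation[OF b(2)]
    note TR = translate[OF a(2) R]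
    note UTR = translate[OF U conjunct1[OF TR]]
    have comm: "U\<inverse> O (T O R) = (T O R) O U\<inverse>"
      using A.relcomp_commute U TR A.thin_relation_in A.thick_relation_in by blast
    \<comment> \<open>Commutativity of \<open>X'\<close> applies because \<open>T O f R\<close> is
      the relation \<open>f (T O R)\<close> of \<open>X'\<close>.\<close>
    have comm': "U\<inverse> O (T O f R) = (T O f R) O U\<inverse>"
      using B.relcomp_commute[OF B.thin_relation_in[OF thin'[OF U]], of "f (T O R)"]
        f_in[of "T O R"] TR A.thick_relation_in by simp
    \<comment> \<open>The path runs from \<open>a\<close> by \<open>T\<close> to \<open>x\<close>,
      by \<open>R\<close> to \<open>y\<close>, and back along \<open>U\<close> to
      \<open>b\<close>.\<close>
    have "(a, b) \<in> U\<inverse> O (T O R)" unfolding comm using xy a b by blast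
    then have "(a, b) \<in> f (U\<inverse> O (T O R))"
      using restr[OF A.thick_relation_in[OF conjunct1[OF UTR]]] a b
      by (auto simp: restrict_rel_def)
    then have "(a, b) \<in> (T O f R) O U\<inverse>" using UTR TR comm' by simp
    then obtain x' y' where "(a, x') \<in> T" "(x', y') \<in> f R" "(b, y') \<in> U" by blast
    \<comment> \<open>\<open>T\<close> and \<open>U\<close> are single-valued, so
      \<open>x' = x\<close> and \<open>y' = y\<close>.\<close>
    then show "(x, y) \<in> f R"
      using a b by (auto simp: A.thin_relation_iff)
  qed
  have "R \<subseteq> f R" if "R \<in> X" for R
    using A.thin_or_thick[OF that] thick_subset f_thin by auto
  with A.partition B.partition bij show ?thesis
    by (rule partition_on_eq_if_bij_betw_subset)
qed

end
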